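(* For every integer $q \geq 3$ and every $\epsilon > 0$, there exists a constant $D=D(\epsilon, q)$ such that for each $n \in \mathbb{N}$ there exist a collection $\mathcal{G} \subset \mathcal{P}([n])$ and a function $f\colon \mathcal{P}([n]) \to \mathcal{G}$ such that: (1) each $G \in \mathcal{G}$ contains fewer than $\epsilon n^2$ arithmetic progressions of length $q$; (2) for every subset $I \subset [n]$ containing no arithmetic progression of length $q$, there exists $S \subset I$ with $|S| \leq D \cdot n^{\frac{q-2}{q-1}}$ and $I \subset f(S)$.
   Context: $[n]=\{1,\dotsc,n\}$ and $\mathcal{P}([n])$ is its power set. Arithmetic progressions have nonzero common difference. *)

theory Defs
  imports Complex_Main "HOL-Library.FuncSet"
begin

text \<open>
  An arithmetic progression is identified with its set of terms. Reversing a progression negates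
  its common difference and keeps this set, so it suffices to let the difference range over the
  nonzero natural numbers.
\<close>

definition arith_prog :: "nat \<Rightarrow> nat set \<Rightarrow> bool" where
  "arith_prog q A \<longleftrightarrow> (\<exists>a d. d \<noteq> 0 \<and> A = (\<lambda>i. a + i * d) ` {..<q})"

definition arith_progs_in :: "nat \<Rightarrow> nat set \<Rightarrow> nat set set" where
  "arith_progs_in q X = {A. arith_prog q A \<and> A \<subseteq> X}"

end

theory Submission
  imports Defs
begin

text \<open>
  The fingerprint of a progression-free set \<open>I\<close> is found by adaptively asking whether \<open>v \<in> I\<close>
  for suitable vertices \<open>v\<close> and keeping the positive answers. Let \<open>p = n powr (-1 / (q - 1))\<close>.
  Always querying vertices of large degree, one collects with about \<open>p * n\<close> positive answers a
  dense \<open>(q - 1)\<close>-uniform hypergraph of links of vertices of \<open>I\<close>, unless linearly many vertices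
  are rejected. In each such round the average degree is scaled by \<open>p\<close>. As two numbers lie in a
  bounded number of progressions of length \<open>q\<close>, only the maximum degree has to be controlled
  along the way. After \<open>q - 1\<close> rounds, \<open>n * p ^ (q - 1) = 1\<close> shows that linearly many vertices
  complete a progression with elements of \<open>I\<close>, hence are not in \<open>I\<close>. So
  each pass shrinks the container by a fixed fraction of \<open>n\<close>, and boundedly many passes suffice.
\<close>

section \<open>Membership queries and fingerprints\<close>

text \<open>In a state \<open>(A, B)\<close>, the vertices in \<open>A\<close> are known to belong to the unknown set and those
  in \<open>B\<close> are known not to. The counter bounds the number of positive answers only.\<close>

inductive strategy :: "('a set \<Rightarrow> 'a set \<Rightarrow> bool) \<Rightarrow> 'a set \<Rightarrow> 'a set \<Rightarrow> nat \<Rightarrow> bool"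
  for T where
  stop: "T A B \<Longrightarrow> strategy T A B k"
| query: "strategy T (insert v A) B k \<Longrightarrow> strategy T A (insert v B) (Suc k)
    \<Longrightarrow> strategy T A B (Suc k)"

lemma strategy_mono:
  assumes "strategy T A B k" and "k \<le> l"
  shows "strategy T A B l"
  using assms
proof (induction arbitrary: l rule: strategy.induct)
  case (stop A B k)
  then show ?case by (simp add: strategy.stop)
next
  case (query v A B k)
  then obtain m where "l = Suc m" "k \<le> m" by (cases l) auto
  moreover have "strategy T (insert v A) B m" "strategy T A (insert v B) (Suc m)"
    using query.IH \<open>k \<le> m\<close> by simp_all
  ultimately show ?case by (simp only: strategy.query)
qed

text \<open>Grafting a second strategy onto every stopping state adds the budgets. Answers are never
  revoked, so the second stage may rely on \<open>A \<subseteq> A'\<close> and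
  \<open>B \<subseteq> B'\<close>.\<close>

lemma strategy_trans:
  assumes "strategy T A B k"
    and "\<And>A' B'. T A' B' \<Longrightarrow> A \<subseteq> A' \<Longrightarrow> B \<subseteq> B' \<Longrightarrow> strategy U A' B' l"
  shows "strategy U A B (k + l)"
  using assms
proof (induction rule: strategy.induct)
  case (stop A B k)
  then show ?case by (blast intro: strategy_mono le_add2)
next
  case (query v A B k)
  have "strategy U (insert v A) B (k + l)" "strategy U A (insert v B) (Suc k + l)"
    by (intro query.IH query.prems; auto)+
  then show ?case by (simp add: strategy.query)
qed

lemma strategy_weaken:
  assumes "strategy T A B k" and "\<And>A' B'. T A' B' \<Longrightarrow> A \<subseteq> A' \<Longrightarrow> B \<subseteq> B' \<Longrightarrow> U A' B'"
  shows "strategy U A B k"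
  using strategy_trans[OF assms(1), of U 0] assms(2) strategy.stop[of U] by simp

text \<open>As a union of compatible sets rather than a complement of \<open>B\<close>, this also
  drops vertices refuted by the positive answers alone, without a query.\<close>

definition container :: "'a set set \<Rightarrow> 'a set \<Rightarrow> 'a set \<Rightarrow> 'a set" where
  "container \<I> A B = \<Union>{I \<in> \<I>. A \<subseteq> I \<and> I \<inter> B = {}}"

lemma container_antimono:
  "A \<subseteq> A' \<Longrightarrow> B \<subseteq> B' \<Longrightarrow> container \<I> A' B' \<subseteq> container \<I> A B"
  unfolding container_def by blast

text \<open>The fingerprint consists of the vertices that received a positive answer. Replaying the
  queries on the fingerprint instead of the set itself gives the same answers, so the final state
  depends on the fingerprint only.\<close>

lemma strategy_imp_containers:
  assumes "strategy (\<lambda>A B. P (container \<I> A B)) A B k"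
  shows "\<exists>f. (\<forall>S. P (f S)) \<and>
    (\<forall>I\<in>\<I>. finite I \<longrightarrow> A \<subseteq> I \<longrightarrow> I \<inter> B = {} \<longrightarrow>
       (\<exists>S. A \<subseteq> S \<and> S \<subseteq> I \<and> card (S - A) \<le> k \<and> I \<subseteq> f S))"
  using assms
proof (induction rule: strategy.induct)
  case (stop A B k)
  show ?case
  proof (intro exI[of _ "\<lambda>_. container \<I> A B"] conjI allI ballI impI)
    fix I assume "I \<in> \<I>" "finite I" "A \<subseteq> I" "I \<inter> B = {}"
    then show "\<exists>S. A \<subseteq> S \<and> S \<subseteq> I \<and> card (S - A) \<le> k \<and> I \<subseteq> container \<I> A B"
      by (intro exI[of _ A]) (auto simp: container_def)
  qed (rule stop)
next
  case (query v A B k)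
  from query.IH(1) obtain f
    where f: "\<forall>S. P (f S)" "\<forall>I\<in>\<I>. finite I \<longrightarrow> insert v A \<subseteq> I \<longrightarrow> I \<inter> B = {} \<longrightarrow>
       (\<exists>S. insert v A \<subseteq> S \<and> S \<subseteq> I \<and> card (S - insert v A) \<le> k \<and> I \<subseteq> f S)"
    by - (elim exE conjE, rule that)
  from query.IH(2) obtain g
    where g: "\<forall>S. P (g S)" "\<forall>I\<in>\<I>. finite I \<longrightarrow> A \<subseteq> I \<longrightarrow> I \<inter> insert v B = {} \<longrightarrow>
       (\<exists>S. A \<subseteq> S \<and> S \<subseteq> I \<and> card (S - A) \<le> Suc k \<and> I \<subseteq> g S)"
    by - (elim exE conjE, rule that)
  show ?case
  \<comment> \<open>Membership in \<open>S\<close> reproduces the answer for \<open>I\<close>: a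
    positive answer puts \<open>v\<close> into \<open>S\<close>, at the cost of one unit of budget,
    and a negative one keeps it out because \<open>S \<subseteq> I\<close>.\<close>
  proof (intro exI[of _ "\<lambda>S. if v \<in> S then f S else g S"] conjI allI ballI impI)
    fix S show "P (if v \<in> S then f S else g S)" using f(1) g(1) by simp
  next
    fix I assume I: "I \<in> \<I>" "finite I" "A \<subseteq> I" "I \<inter> B = {}"
    show "\<exists>S. A \<subseteq> S \<and> S \<subseteq> I \<and> card (S - A) \<le> Suc k
        \<and> I \<subseteq> (if v \<in> S then f S else g S)"
    proof (cases "v \<in> I")
      case True
      with I f(2) obtain S where S: "insert v A \<subseteq> S" "S \<subseteq> I" "card (S - insert v A) \<le> k" "I \<subseteq> f S"
        by (metis insert_subset)
      have "card (S - A) \<le> card (insert v (S - insert v A))"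
        using S(2) I(2) finite_subset by (intro card_mono) auto
      also have "\<dots> \<le> Suc k"
        using S(3) card_insert_le_m1[of "Suc k" "S - insert v A" v] by simp
      finally show ?thesis using S by auto
    next
      case False
      with I have "I \<inter> insert v B = {}" by auto
      with I g(2) obtain S where "A \<subseteq> S" "S \<subseteq> I" "card (S - A) \<le> Suc k" "I \<subseteq> g S"
        by meson
      with False show ?thesis by auto
    qed
  qed
qed

section \<open>Passing to links\<close>

lemma card_meeting_le:
  fixes c :: real
  assumes "finite Y" and "finite E" and "\<And>v. v \<in> Y \<Longrightarrow> real (card {e \<in> E. v \<in> R e}) \<le> c"
  shows "real (card {e \<in> E. R e \<inter> Y \<noteq> {}}) \<le> real (card Y) * c"
proof -
  have "{e \<in> E. R e \<inter> Y \<noteq> {}} = (\<Union>v\<in>Y. {e \<in> E. v \<in> R e})" by auto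
  then have "card {e \<in> E. R e \<inter> Y \<noteq> {}} \<le> (\<Sum>v\<in>Y. card {e \<in> E. v \<in> R e})"
    using assms(1) by (simp add: card_UN_le)
  then have "real (card {e \<in> E. R e \<inter> Y \<noteq> {}}) \<le> (\<Sum>v\<in>Y. real (card {e \<in> E. v \<in> R e}))"
    by (simp only: of_nat_sum[symmetric] of_nat_le_iff)
  also have "\<dots> \<le> real (card Y) * c"
    using sum_bounded_above[of Y "\<lambda>v. real (card {e \<in> E. v \<in> R e})" c] assms(3) by simp
  finally show ?thesis .
qed

text \<open>Double counting of incidences. It serves to show that few vertices are saturated while
  few edges are collected.\<close>

lemma card_high_degree_le:
  fixes c :: real
  assumes "finite Y" and "finite E" and "\<And>e. e \<in> E \<Longrightarrow> finite (R e) \<and> card (R e) \<le> q"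
    and "\<And>v. v \<in> Y \<Longrightarrow> c \<le> real (card {e \<in> E. v \<in> R e})"
  shows "real (card Y) * c \<le> real q * real (card E)"
proof -
  have "real (card Y) * c \<le> (\<Sum>v\<in>Y. real (card {e \<in> E. v \<in> R e}))"
    using sum_bounded_below[of Y c "\<lambda>v. real (card {e \<in> E. v \<in> R e})"] assms(4) by simp
  also have "\<dots> = real (\<Sum>v\<in>Y. \<Sum>e\<in>{e \<in> E. v \<in> R e}. 1)"
    by simp
  also have "(\<Sum>v\<in>Y. \<Sum>e\<in>{e \<in> E. v \<in> R e}. 1) = (\<Sum>e\<in>E. \<Sum>v\<in>{v \<in> Y. v \<in> R e}. 1)"
    using assms(1,2) by (rule sum.swap_restrict)
  also have "\<dots> \<le> (\<Sum>e\<in>E. q)"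
  proof (rule sum_mono)
    fix e assume "e \<in> E"
    then have "card {v \<in> Y. v \<in> R e} \<le> card (R e)"
      using assms(3) by (intro card_mono) auto
    also have "\<dots> \<le> q" using assms(3) \<open>e \<in> E\<close> by blast
    finally show "(\<Sum>v\<in>{v \<in> Y. v \<in> R e}. 1) \<le> q" by simp
  qed
  finally show ?thesis by (simp add: mult.commute)
qed

text \<open>An edge of the iterated link hypergraph is stored as the original edge \<open>e\<close> together with the
  part \<open>R e\<close> left after deleting the chosen vertices, so codegrees are inherited from \<open>H\<close>.\<close>

definition residual ::
  "'a set set \<Rightarrow> 'a set \<Rightarrow> nat \<Rightarrow> real \<Rightarrow> 'a set \<Rightarrow> 'a set set \<Rightarrow> ('a set \<Rightarrow> 'a set) \<Rightarrow> bool" where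
  "residual H X r c A E R \<longleftrightarrow> E \<subseteq> H \<and>
     (\<forall>e\<in>E. R e \<subseteq> X \<and> R e \<subseteq> e \<and> e \<subseteq> R e \<union> A \<and> card (R e) = r) \<and>
     (\<forall>v. real (card {e \<in> E. v \<in> R e}) \<le> c)"

text \<open>A vertex is saturated once its degree among the links collected so far is at least
  \<open>K * p * d\<close>; edges through saturated vertices are not collected, which keeps the maximum degree
  of the link hypergraph under control. Unless many vertices are rejected, few edges are lost by
  this: many saturated vertices mean many collected edges.\<close>

lemma strategy_link:
  fixes H :: "'a set set" and X :: "'a set" and n d p \<alpha> K :: real
  assumes finX: "finite X" "real (card X) \<le> n" and finH: "finite H"
    and codeg: "\<And>u v. u \<noteq> v \<Longrightarrow> real (card {e \<in> H. u \<in> e \<and> v \<in> e}) \<le> K"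
    and pos: "d > 0" "0 < p" "p \<le> 1" "p * d \<ge> 1" "\<alpha> > 0" "K > 0" "n > 0"
    and res: "residual H X (Suc r) (K * d) A0 E R"
    and edges: "real (card E) \<ge> \<alpha> * n * d"
    and k: "real k \<ge> p * n"
  shows "strategy (\<lambda>A B. real (card (X \<inter> B)) \<ge> \<alpha> / (4 * K) * n \<or>
      (\<exists>E' R'. residual H X r (2 * K * (p * d)) A E' R' \<and>
         real (card E') \<ge> \<alpha> / (4 * real (Suc r)) * n * (p * d))) A0 B0 k"
proof -
  \<comment> \<open>\<open>g e\<close> is the vertex whose positive answer caused \<open>e\<close>
    to be collected; deleting it from \<open>R e\<close> leaves the link edge.\<close>
  define deg where "deg = (\<lambda>E' g u. real (card {e \<in> E'. u \<in> R e - {g e :: 'a}}))"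
  define \<alpha>' where "\<alpha>' = \<alpha> / (4 * real (Suc r))"
  define T where "T = (\<lambda>A B. real (card (X \<inter> B)) \<ge> \<alpha> / (4 * K) * n \<or>
      (\<exists>E' R'. residual H X r (2 * K * (p * d)) A E' R' \<and> real (card E') \<ge> \<alpha>' * n * (p * d)))"
  \<comment> \<open>\<open>Q\<close> holds the positive answers of this round. Call an uncollected
    edge live if it avoids \<open>B\<close> and all saturated vertices. Live edges avoid
    \<open>Q\<close>, since a positive answer collects every live edge at its vertex. The extra
    \<open>K\<close> is the overshoot possible in one query.\<close>
  define inv where "inv = (\<lambda>A B Q E' g. A0 \<subseteq> A \<and> E' \<subseteq> E \<and> (\<forall>e\<in>E'. g e \<in> R e \<inter> A) \<and>
      (\<forall>u. deg E' g u \<le> K * (p * d) + K) \<and>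
      (\<forall>e\<in>E - E'. R e \<inter> B = {} \<and> (\<forall>u\<in>R e. deg E' g u < K * (p * d)) \<longrightarrow> R e \<inter> Q = {}))"
  have finE: "finite E" using res finH unfolding residual_def by (blast intro: finite_subset)
  have R: "R e \<subseteq> X" "R e \<subseteq> e" "e \<subseteq> R e \<union> A0" "card (R e) = Suc r" "finite (R e)" "e \<in> H"
    if "e \<in> E" for e
  proof -
    show "R e \<subseteq> X" "R e \<subseteq> e" "e \<subseteq> R e \<union> A0" "card (R e) = Suc r" "e \<in> H"
      using res that unfolding residual_def by blast+
    then show "finite (R e)" using finX(1) finite_subset by blast
  qed
  have degE: "real (card {e \<in> E. v \<in> R e}) \<le> K * d" for v
    using res unfolding residual_def by blast
  \<comment> \<open>The budget inequality says that \<open>\<alpha> / 4 * d\<close> new edges per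
    remaining positive answer suffice to reach the target.\<close>
  have main: "strategy T A B k"
    if "inv A B Q E' g" and "real (card E') + real k * (\<alpha> / 4 * d) \<ge> \<alpha>' * n * (p * d)"
    for A B Q E' g k
    using that
  proof (induction "card (X - (Q \<union> B))" arbitrary: A B Q E' g k rule: less_induct)
    case less
    have inv: "A0 \<subseteq> A" "E' \<subseteq> E" "\<And>e. e \<in> E' \<Longrightarrow> g e \<in> R e" "\<And>e. e \<in> E' \<Longrightarrow> g e \<in> A"
      "\<And>u. deg E' g u \<le> K * (p * d) + K"
      and dead: "\<And>e. e \<in> E \<Longrightarrow> e \<notin> E' \<Longrightarrow> R e \<inter> B = {} \<Longrightarrow>
        (\<And>u. u \<in> R e \<Longrightarrow> deg E' g u < K * (p * d)) \<Longrightarrow> R e \<inter> Q = {}"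
      using less.prems(1) unfolding inv_def by auto
    have finE': "finite E'" using inv(2) finE by (rule finite_subset)
    show ?case
    proof (cases "T A B")
      case True
      then show ?thesis by (rule strategy.stop)
    next
      case False
      have "residual H X r (2 * K * (p * d)) A E' (\<lambda>e. R e - {g e})"
        unfolding residual_def
      proof (intro conjI ballI allI)
        show "E' \<subseteq> H" using inv(2) R(6) by blast
      next
        fix e assume e: "e \<in> E'"
        then have E: "e \<in> E" using inv(2) by auto
        show "R e - {g e} \<subseteq> X" "R e - {g e} \<subseteq> e" using R(1,2)[OF E] by auto
        show "e \<subseteq> R e - {g e} \<union> A" using R(3)[OF E] inv(1) inv(4)[OF e] by blast
        show "card (R e - {g e}) = r" using R(4,5)[OF E] inv(3)[OF e] by simp
      next
        fix v
        have "deg E' g v \<le> K * (p * d) + K * 1" using inv(5)[of v] by simp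
        also have "\<dots> \<le> K * (p * d) + K * (p * d)"
          using pos by (intro add_left_mono mult_left_mono) auto
        finally show "real (card {e \<in> E'. v \<in> R e - {g e}}) \<le> 2 * K * (p * d)"
          by (simp add: deg_def mult_ac)
      qed
      with False have small: "real (card E') < \<alpha>' * n * (p * d)"
        and rejected: "real (card (X \<inter> B)) < \<alpha> / (4 * K) * n"
        unfolding T_def by (auto simp: not_le)
      \<comment> \<open>With \<open>k = 0\<close> the budget inequality would contradict
        \<open>small\<close>.\<close>
      from small less.prems(2) obtain k' where k': "k = Suc k'" by (cases k) auto
      define L where "L = {e \<in> E - E'. R e \<inter> B = {} \<and> (\<forall>u\<in>R e. deg E' g u < K * (p * d))}"
      \<comment> \<open>Otherwise \<open>E\<close> is too small: it is covered by the collected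
        edges, the live edges, and the edges meeting \<open>B\<close> or \<open>Sat\<close>. Each
        class has at most \<open>\<alpha> * n * d / 4\<close> members, the first one strictly
        fewer.\<close>
      have "\<exists>v\<in>X. real (card {e \<in> L. v \<in> R e}) \<ge> \<alpha> / 4 * d"
      proof (rule ccontr)
        assume "\<not> ?thesis"
        then have lowdeg: "real (card {e \<in> L. v \<in> R e}) \<le> \<alpha> / 4 * d" if "v \<in> X" for v
          using that by force
        define Sat where "Sat = {u \<in> X. deg E' g u \<ge> K * (p * d)}"
        have "R e \<inter> X \<noteq> {}" if "e \<in> L" for e
        proof -
          have "e \<in> E" using that by (simp add: L_def)
          then have "R e \<subseteq> X" "R e \<noteq> {}" using R(1,4)[of e] by auto
          then show ?thesis by auto
        qed
        then have "L = {e \<in> L. R e \<inter> X \<noteq> {}}" by auto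
        then have "real (card L) \<le> real (card X) * (\<alpha> / 4 * d)"
          using card_meeting_le[of X L R "\<alpha> / 4 * d"] lowdeg finX finE unfolding L_def by auto
        also have "\<dots> \<le> n * (\<alpha> / 4 * d)"
          using finX pos by (intro mult_right_mono) auto
        finally have cL: "real (card L) \<le> \<alpha> * n * d / 4" by (simp add: mult_ac)
        have "real (card {e \<in> E. R e \<inter> (X \<inter> B) \<noteq> {}}) \<le> real (card (X \<inter> B)) * (K * d)"
          using finX finE degE by (intro card_meeting_le) auto
        also have "\<dots> \<le> \<alpha> / (4 * K) * n * (K * d)"
          using rejected pos by (intro mult_right_mono) auto
        finally have cB: "real (card {e \<in> E. R e \<inter> (X \<inter> B) \<noteq> {}}) \<le> \<alpha> * n * d / 4"
          using pos by (simp add: field_simps)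
        \<comment> \<open>The factor \<open>p\<close> turns the degree bound \<open>K * d\<close>
          into the saturation threshold. Double counting then costs a factor \<open>Suc r\<close>,
          which the denominator of \<open>\<alpha>'\<close> absorbs.\<close>
        have "real (card {e \<in> E. R e \<inter> Sat \<noteq> {}}) * p \<le> (real (card Sat) * (K * d)) * p"
          using finX finE degE pos
          by (intro mult_right_mono card_meeting_le) (auto simp: Sat_def)
        also have "\<dots> = real (card Sat) * (K * (p * d))" by simp
        also have "\<dots> \<le> real (Suc r) * real (card E')"
        proof (rule card_high_degree_le[where R = "\<lambda>e. R e - {g e}"])
          fix e assume "e \<in> E'"
          then have "e \<in> E" using inv(2) by auto
          then show "finite (R e - {g e}) \<and> card (R e - {g e}) \<le> Suc r"
            using R(4,5)[of e] card_Diff1_le[of "R e" "g e"] by simp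
        qed (use finX finE' in \<open>auto simp: Sat_def deg_def\<close>)
        also have "\<dots> \<le> real (Suc r) * (\<alpha>' * n * (p * d))"
          using small by (intro mult_left_mono) auto
        also have "\<dots> = (\<alpha> * n * d / 4) * p" by (simp add: \<alpha>'_def divide_simps)
        finally have cS: "real (card {e \<in> E. R e \<inter> Sat \<noteq> {}}) \<le> \<alpha> * n * d / 4"
          using pos(2) by simp
        have "\<alpha>' \<le> \<alpha> / 4" unfolding \<alpha>'_def using pos by (simp add: field_simps)
        then have "\<alpha>' * n * (p * d) \<le> \<alpha> / 4 * n * (1 * d)"
          using pos by (intro mult_mono) (auto simp: \<alpha>'_def)
        with small have cE': "real (card E') < \<alpha> * n * d / 4" by simp
        have "E \<subseteq> E' \<union> (L \<union> ({e \<in> E. R e \<inter> (X \<inter> B) \<noteq> {}} \<union> {e \<in> E. R e \<inter> Sat \<noteq> {}}))"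
          unfolding L_def Sat_def using R(1) by (fastforce simp: not_less)
        then have "card E \<le> card (E' \<union> (L \<union> ({e \<in> E. R e \<inter> (X \<inter> B) \<noteq> {}} \<union> {e \<in> E. R e \<inter> Sat \<noteq> {}})))"
          using finE finE' by (intro card_mono) (auto simp: L_def)
        also have "\<dots> \<le> card E' + (card L + (card {e \<in> E. R e \<inter> (X \<inter> B) \<noteq> {}} + card {e \<in> E. R e \<inter> Sat \<noteq> {}}))"
          by (meson card_Un_le add_left_mono order_trans)
        finally have "real (card E) < \<alpha> * n * d"
          using cL cB cS cE' by linarith
        with edges show False by simp
      qed
      then obtain v where v: "v \<in> X" "real (card {e \<in> L. v \<in> R e}) \<ge> \<alpha> / 4 * d" by blast
      define Lv where "Lv = {e \<in> L. v \<in> R e}"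
      have LvE: "Lv \<subseteq> E - E'" unfolding Lv_def L_def by auto
      have finLv: "finite Lv" using LvE finE finite_subset by blast
      have "Lv \<noteq> {}"
      proof
        assume "Lv = {}"
        with v(2) pos show False unfolding Lv_def by (simp add: mult_le_0_iff)
      qed
      then obtain e where "e \<in> L" "v \<in> R e" unfolding Lv_def by auto
      \<comment> \<open>A live edge through \<open>v\<close> avoids \<open>B\<close> by definition
        and \<open>Q\<close> by the invariant. So \<open>v\<close> is new, and the induction measure
        drops for either answer.\<close>
      then have vQB: "v \<notin> Q \<union> B" using dead[of e] unfolding L_def by auto
      have dec: "card (X - (insert v Q \<union> B)) < card (X - (Q \<union> B))"
        "card (X - (Q \<union> insert v B)) < card (X - (Q \<union> B))"
        using vQB v(1) finX(1) by (intro psubset_card_mono; blast)+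
      define g' where "g' = (\<lambda>e. if e \<in> Lv then v else g e)"
      have deg': "deg (E' \<union> Lv) g' u = deg E' g u + real (card {e \<in> Lv. u \<in> R e - {v}})" for u
      proof -
        have "{e \<in> E' \<union> Lv. u \<in> R e - {g' e}}
            = {e \<in> E'. u \<in> R e - {g e}} \<union> {e \<in> Lv. u \<in> R e - {v}}"
          using LvE by (auto simp: g'_def)
        moreover have "{e \<in> E'. u \<in> R e - {g e}} \<inter> {e \<in> Lv. u \<in> R e - {v}} = {}"
          using LvE by auto
        ultimately show ?thesis
          unfolding deg_def using finE' finLv by (simp add: card_Un_disjoint)
      qed
      \<comment> \<open>Only live edges are added, so a degree that grows was below the threshold,
        and it grows by at most the codegree with \<open>v\<close>.\<close>
      have bound: "deg (E' \<union> Lv) g' u \<le> K * (p * d) + K" for u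
      proof (cases "{e \<in> Lv. u \<in> R e - {v}} = {}")
        case True
        then show ?thesis using deg'[of u] inv(5)[of u] by (simp only: card.empty of_nat_0)
      next
        case False
        then obtain e where e: "e \<in> Lv" "u \<in> R e" "u \<noteq> v" by auto
        then have "deg E' g u < K * (p * d)" unfolding Lv_def L_def by auto
        moreover have "{e \<in> Lv. u \<in> R e - {v}} \<subseteq> {e \<in> H. u \<in> e \<and> v \<in> e}"
          using LvE R(2,6) unfolding Lv_def by blast
        then have "card {e \<in> Lv. u \<in> R e - {v}} \<le> card {e \<in> H. u \<in> e \<and> v \<in> e}"
          using finH by (intro card_mono) auto
        ultimately show ?thesis using deg'[of u] codeg[OF e(3)] by linarith
      qed
      have "inv (insert v A) B (insert v Q) (E' \<union> Lv) g'"
        unfolding inv_def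
      proof (intro conjI ballI allI impI)
        show "A0 \<subseteq> insert v A" "E' \<union> Lv \<subseteq> E" using inv(1,2) LvE by auto
      next
        fix e assume "e \<in> E' \<union> Lv"
        then show "g' e \<in> R e \<inter> insert v A"
          using inv(3,4) by (auto simp: g'_def Lv_def)
      next
        fix e assume e: "e \<in> E - (E' \<union> Lv)"
          and *: "R e \<inter> B = {} \<and> (\<forall>u\<in>R e. deg (E' \<union> Lv) g' u < K * (p * d))"
        have "deg E' g u < K * (p * d)" if "u \<in> R e" for u
          using * that deg'[of u] by fastforce
        with e * have "e \<in> L" by (auto simp: L_def)
        with e have "v \<notin> R e" by (auto simp: Lv_def)
        moreover have "R e \<inter> Q = {}" using \<open>e \<in> L\<close> dead[of e] unfolding L_def by auto
        ultimately show "R e \<inter> insert v Q = {}" by auto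
      qed (rule bound)
      moreover have "\<alpha>' * n * (p * d) \<le> real (card (E' \<union> Lv)) + real k' * (\<alpha> / 4 * d)"
      proof -
        have "card (E' \<union> Lv) = card E' + card Lv"
          using finE' finLv LvE by (intro card_Un_disjoint) auto
        moreover have "real k * (\<alpha> / 4 * d) = \<alpha> / 4 * d + real k' * (\<alpha> / 4 * d)"
          unfolding k' by (simp add: algebra_simps)
        ultimately show ?thesis using v(2)[folded Lv_def] less.prems(2) by linarith
      qed
      ultimately have 1: "strategy T (insert v A) B k'"
        by (rule less.hyps[OF dec(1)])
      \<comment> \<open>A rejection creates no live edge and costs no budget.\<close>
      have "inv A (insert v B) Q E' g"
        using inv dead unfolding inv_def by auto
      then have 2: "strategy T A (insert v B) (Suc k')"
        using less.hyps[OF dec(2)] less.prems(2) k' by blast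
      show ?thesis unfolding k' using 1 2 by (rule strategy.query)
    qed
  qed
  have "inv A0 B0 {} {} undefined"
    unfolding inv_def deg_def using pos by simp
  moreover have "\<alpha>' * n * (p * d) \<le> real k * (\<alpha> / 4 * d)"
  proof -
    have "\<alpha>' \<le> \<alpha> / 4" unfolding \<alpha>'_def using pos by (simp add: field_simps)
    then have "\<alpha>' * n * (p * d) \<le> \<alpha> / 4 * n * (p * d)"
      using pos by (intro mult_right_mono) auto
    also have "\<dots> = (p * n) * (\<alpha> / 4 * d)" by simp
    also have "\<dots> \<le> real k * (\<alpha> / 4 * d)"
      using k pos by (intro mult_right_mono) auto
    finally show ?thesis .
  qed
  ultimately have "strategy T A0 B0 k" using main[of A0 B0 "{}" "{}"] by simp
  then show ?thesis unfolding T_def \<alpha>'_def .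
qed

text \<open>The parameters \<open>\<alpha>\<close> and \<open>K\<close> evolve under passing to links as in \<open>strategy_link\<close>.\<close>

fun shrinkage :: "nat \<Rightarrow> real \<Rightarrow> real \<Rightarrow> real" where
  "shrinkage 0 \<alpha> K = \<alpha> / K"
| "shrinkage (Suc s) \<alpha> K =
    min (\<alpha> / (4 * K)) (shrinkage s (\<alpha> / (4 * real (Suc (Suc s)))) (2 * K))"

lemma shrinkage_pos: "\<alpha> > 0 \<Longrightarrow> K > 0 \<Longrightarrow> shrinkage s \<alpha> K > 0"
  by (induction s \<alpha> K rule: shrinkage.induct) auto

text \<open>Each round of \<open>strategy_link\<close> either has many vertices rejected, all
  outside the container, or lowers the uniformity by one. At uniformity one, each residual vertex
  completes an edge of \<open>H\<close> with elements of \<open>A\<close>, so it too is outside the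
  container.\<close>

lemma strategy_shrink:
  fixes H :: "'a set set" and X :: "'a set" and n d p \<alpha> K :: real
  assumes "finite X" "real (card X) \<le> n" and "finite H"
    and "\<And>u v. u \<noteq> v \<Longrightarrow> real (card {e \<in> H. u \<in> e \<and> v \<in> e}) \<le> K"
    and "d > 0" "0 < p" "p \<le> 1" "p ^ s * d \<ge> 1" "\<alpha> > 0" "K > 0" "n > 0"
    and "residual H X (Suc s) (K * d) A E R"
    and "real (card E) \<ge> \<alpha> * n * d"
    and "real k \<ge> p * n"
    and "\<And>I e. I \<in> \<I> \<Longrightarrow> e \<in> H \<Longrightarrow> \<not> e \<subseteq> I"
  shows "strategy (\<lambda>A B. real (card (X - container \<I> A B)) \<ge> shrinkage s \<alpha> K * n) A B (s * k)"
  using assms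
proof (induction s arbitrary: \<alpha> K d A B E R)
  case 0
  note res = \<open>residual H X (Suc 0) (K * d) A E R\<close>[unfolded residual_def]
  have finE: "finite E" using res \<open>finite H\<close> by (auto intro: finite_subset)
  have R: "R e \<subseteq> X" "card (R e) = Suc 0" "R e \<inter> container \<I> A B = {}" if e: "e \<in> E" for e
  proof -
    show "R e \<subseteq> X" and c: "card (R e) = Suc 0" using res e by auto
    obtain u where u: "R e = {u}" using c by (auto simp: card_Suc_eq)
    have "e \<in> H" "e \<subseteq> R e \<union> A" using res e by blast+
    then have "u \<notin> I" if "I \<in> \<I>" "A \<subseteq> I" for I
      using 0(15)[OF that(1), of e] that(2) u by auto
    then show "R e \<inter> container \<I> A B = {}" unfolding u container_def by blast
  qed
  have "R e \<inter> (X - container \<I> A B) \<noteq> {}" if "e \<in> E" for e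
  proof -
    have "R e \<noteq> {}" using R(2)[OF that] by auto
    then show ?thesis using R(1,3)[OF that] by blast
  qed
  then have "E = {e \<in> E. R e \<inter> (X - container \<I> A B) \<noteq> {}}" by auto
  \<comment> \<open>Dividing the number of edges by the maximum degree \<open>K * d\<close> gives
    the fraction \<open>\<alpha> / K\<close>.\<close>
  then have "real (card E) \<le> real (card (X - container \<I> A B)) * (K * d)"
    using card_meeting_le[of "X - container \<I> A B" E R "K * d"] 0 finE res by auto
  with \<open>real (card E) \<ge> \<alpha> * n * d\<close>
  have "(\<alpha> * n) * d \<le> (real (card (X - container \<I> A B)) * K) * d" by (simp add: mult.assoc)
  then have "\<alpha> * n \<le> real (card (X - container \<I> A B)) * K" using 0 by simp
  then show ?case using 0 by (intro strategy.stop) (simp add: field_simps)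
next
  case (Suc s)
  let ?\<alpha>' = "\<alpha> / (4 * real (Suc (Suc s)))"
  let ?T = "\<lambda>A B. real (card (X - container \<I> A B)) \<ge> shrinkage (Suc s) \<alpha> K * n"
  have "p ^ Suc s * d \<le> p * d" using power_decreasing[of 1 "Suc s" p] Suc.prems
    by (intro mult_right_mono) auto
  then have pd: "p * d \<ge> 1" using Suc.prems by linarith
  have first: "strategy (\<lambda>A B. real (card (X \<inter> B)) \<ge> \<alpha> / (4 * K) * n \<or>
      (\<exists>E' R'. residual H X (Suc s) (2 * K * (p * d)) A E' R' \<and>
         real (card E') \<ge> ?\<alpha>' * n * (p * d))) A B k"
    by (rule strategy_link[OF Suc.prems(1-7) pd Suc.prems(9-14)])
  have "strategy ?T A B (k + s * k)"
  proof (rule strategy_trans[OF first])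
    fix A' B'
    assume "real (card (X \<inter> B')) \<ge> \<alpha> / (4 * K) * n \<or>
      (\<exists>E' R'. residual H X (Suc s) (2 * K * (p * d)) A' E' R' \<and>
         real (card E') \<ge> ?\<alpha>' * n * (p * d))"
    then show "strategy ?T A' B' (s * k)"
    proof (elim disjE exE conjE)
      assume *: "real (card (X \<inter> B')) \<ge> \<alpha> / (4 * K) * n"
      have "card (X \<inter> B') \<le> card (X - container \<I> A' B')"
        using Suc.prems(1) by (intro card_mono) (auto simp: container_def)
      moreover have "shrinkage (Suc s) \<alpha> K * n \<le> \<alpha> / (4 * K) * n"
        using Suc.prems(11) by (intro mult_right_mono) auto
      ultimately show ?thesis using * by (intro strategy.stop) linarith
    next
      fix E' R'
      assume *: "residual H X (Suc s) (2 * K * (p * d)) A' E' R'"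
        "real (card E') \<ge> ?\<alpha>' * n * (p * d)"
      have codeg: "real (card {e \<in> H. u \<in> e \<and> v \<in> e}) \<le> 2 * K" if "u \<noteq> v" for u v
        using Suc.prems(4)[OF that] Suc.prems(10) by linarith
      have "strategy (\<lambda>A B. real (card (X - container \<I> A B)) \<ge> shrinkage s ?\<alpha>' (2 * K) * n)
          A' B' (s * k)"
        using Suc.prems *
        by (intro Suc.IH[where d = "p * d" and E = E' and R = R'] codeg) (auto simp: mult_ac)
      moreover have "shrinkage (Suc s) \<alpha> K * n \<le> shrinkage s ?\<alpha>' (2 * K) * n"
        using Suc.prems(11) by (intro mult_right_mono) auto
      ultimately show ?thesis by (elim strategy_weaken) linarith
    qed
  qed
  then show ?case by simp
qed

section \<open>Arithmetic progressions\<close>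

lemma finite_arith_progs_in: "finite X \<Longrightarrow> finite (arith_progs_in q X)"
  unfolding arith_progs_in_def by (rule finite_subset[of _ "Pow X"]) auto

lemma card_arith_prog: "arith_prog q e \<Longrightarrow> card e = q"
  unfolding arith_prog_def by (auto simp: card_image inj_on_def)

text \<open>The position of \<open>v\<close> and the difference determine the progression; a second
  term inside \<open>{1..n}\<close> forces \<open>d \<le> n\<close>.\<close>

lemma card_arith_progs_containing:
  assumes "q \<ge> 2"
  shows "card {e \<in> arith_progs_in q {1..n}. v \<in> e} \<le> q * n"
proof -
  let ?F = "\<lambda>(i, d). (\<lambda>j. v - i * d + j * d) ` {..<q}"
  have "{e \<in> arith_progs_in q {1..n}. v \<in> e} \<subseteq> ?F ` ({..<q} \<times> {1..n})"
  proof clarify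
    fix e assume "e \<in> arith_progs_in q {1..n}" "v \<in> e"
    then obtain a d i where e: "d \<noteq> 0" "e = (\<lambda>i. a + i * d) ` {..<q}" "i < q" "v = a + i * d"
      and n: "e \<subseteq> {1..n}"
      unfolding arith_progs_in_def arith_prog_def by auto
    have "a + 1 * d \<in> e" unfolding e(2) using assms by (intro image_eqI[of _ _ 1]) auto
    with n have "d \<le> n" by auto
    moreover have "e = ?F (i, d)" using e by simp
    ultimately show "e \<in> ?F ` ({..<q} \<times> {1..n})" using e by (intro image_eqI[of _ _ "(i, d)"]) auto
  qed
  then have "card {e \<in> arith_progs_in q {1..n}. v \<in> e} \<le> card ({..<q} \<times> {1..n})"
    by (intro surj_card_le) auto
  then show ?thesis by simp
qed

text \<open>The positions of \<open>u\<close> and \<open>v\<close> determine the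
  progression.\<close>

lemma card_arith_progs_containing_two:
  assumes "u \<noteq> v"
  shows "card {e \<in> arith_progs_in q X. u \<in> e \<and> v \<in> e} \<le> q * q"
proof -
  \<comment> \<open>Integers allow either order of the positions. For \<open>i = j\<close> the
    division by zero merely adds a junk value to the image.\<close>
  let ?d = "\<lambda>i j. (int v - int u) div (int j - int i)"
  let ?F = "\<lambda>(i, j). (\<lambda>l. nat (int u + (int l - int i) * ?d i j)) ` {..<q}"
  have "{e \<in> arith_progs_in q X. u \<in> e \<and> v \<in> e} \<subseteq> ?F ` ({..<q} \<times> {..<q})"
  proof clarify
    fix e assume "e \<in> arith_progs_in q X" "u \<in> e" "v \<in> e"
    then obtain a d i j where e: "e = (\<lambda>i. a + i * d) ` {..<q}" "i < q" "u = a + i * d"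
      "j < q" "v = a + j * d"
      unfolding arith_progs_in_def arith_prog_def by auto
    have "i \<noteq> j" using e assms by auto
    moreover have "int v - int u = (int j - int i) * int d" using e by (simp add: algebra_simps)
    ultimately have "?d i j = int d" by simp
    then have "int u + (int l - int i) * ?d i j = int (a + l * d)" for l
      using e by (simp add: algebra_simps)
    then have "e = ?F (i, j)" unfolding e(1) by (simp del: of_nat_add of_nat_mult)
    then show "e \<in> ?F ` ({..<q} \<times> {..<q})" using e by (intro image_eqI[of _ _ "(i, j)"]) auto
  qed
  then have "card {e \<in> arith_progs_in q X. u \<in> e \<and> v \<in> e} \<le> card ({..<q} \<times> {..<q})"
    by (intro surj_card_le) auto
  then show ?thesis by simp
qed

text \<open>While the container has at least \<open>\<epsilon> * real n ^ 2\<close> progressions,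
  one more pass of \<open>strategy_shrink\<close> removes at least \<open>\<delta> * real n\<close>
  elements from it.\<close>

lemma strategy_arith_progs:
  fixes q n :: nat and \<epsilon> p :: real
  assumes "q \<ge> 3" "\<epsilon> > 0" "n \<ge> 1" and p: "0 < p" "p \<le> 1" "p ^ (q - 1) * real n \<ge> 1"
    and k: "real k \<ge> p * real n"
  defines "\<I> \<equiv> {I. I \<subseteq> {1..n} \<and> arith_progs_in q I = {}}"
    and "\<delta> \<equiv> shrinkage (q - 1) \<epsilon> (real (q * q))"
  shows "strategy (\<lambda>A B. real (card (arith_progs_in q (container \<I> A B))) < \<epsilon> * real n ^ 2 \<or>
      real (card (container \<I> A B)) \<le> real n - real j * \<delta> * real n) {} {} (j * ((q - 1) * k))"
proof (induction j)
  case 0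
  have "container \<I> {} {} \<subseteq> {1..n}" unfolding container_def \<I>_def by auto
  then have "card (container \<I> {} {}) \<le> n" using card_mono[of "{1..n}"] by fastforce
  then show ?case by (intro strategy.stop) simp
next
  case (Suc j)
  let ?few = "\<lambda>A B. real (card (arith_progs_in q (container \<I> A B))) < \<epsilon> * real n ^ 2"
  let ?small = "\<lambda>j A B. real (card (container \<I> A B)) \<le> real n - real j * \<delta> * real n"
  have "strategy (\<lambda>A B. ?few A B \<or> ?small (Suc j) A B) {} {} (j * ((q - 1) * k) + (q - 1) * k)"
  proof (rule strategy_trans[OF Suc.IH])
    fix A B assume AB: "?few A B \<or> ?small j A B"
    show "strategy (\<lambda>A B. ?few A B \<or> ?small (Suc j) A B) A B ((q - 1) * k)"
    proof (cases "?few A B")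
      case True
      then show ?thesis by (intro strategy.stop) simp
    next
      case False
      let ?X = "container \<I> A B" and ?H = "arith_progs_in q {1..n}"
      have X: "?X \<subseteq> {1..n}" unfolding container_def \<I>_def by auto
      then have finX: "finite ?X" and cX: "real (card ?X) \<le> real n"
        using finite_subset card_mono[of "{1..n}" ?X] by auto
      have finH: "finite ?H" by (simp add: finite_arith_progs_in)
      have sub: "arith_progs_in q ?X \<subseteq> ?H" using X unfolding arith_progs_in_def by auto
      have deg: "real (card {e \<in> arith_progs_in q ?X. v \<in> e}) \<le> real (q * q) * real n" for v
      proof -
        have "card {e \<in> arith_progs_in q ?X. v \<in> e} \<le> card {e \<in> ?H. v \<in> e}"
          using sub finH by (intro card_mono) auto
        also have "\<dots> \<le> q * n" using assms(1) by (intro card_arith_progs_containing) simp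
        \<comment> \<open>Weakened so that \<open>K = q * q\<close> bounds both the codegrees and
          the degrees divided by \<open>n\<close>.\<close>
        also have "\<dots> \<le> q * q * n" using assms(1) by simp
        finally show ?thesis by (metis of_nat_le_iff of_nat_mult)
      qed
      have codeg: "real (card {e \<in> ?H. u \<in> e \<and> v \<in> e}) \<le> real (q * q)" if "u \<noteq> v" for u v
        using card_arith_progs_containing_two[OF that] of_nat_le_iff by blast
      have res: "residual ?H ?X (Suc (q - 1)) (real (q * q) * real n) A (arith_progs_in q ?X) (\<lambda>e. e)"
        unfolding residual_def using sub deg assms(1)
        by (auto simp: arith_progs_in_def card_arith_prog)
      have "strategy (\<lambda>A' B'. real (card (?X - container \<I> A' B')) \<ge> \<delta> * real n) A B ((q - 1) * k)"
        unfolding \<delta>_def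
      \<comment> \<open>Here \<open>d = n\<close> and \<open>\<alpha> = \<epsilon>\<close>;
        uniformity \<open>q\<close> means \<open>q - 1\<close> rounds.\<close>
      proof (rule strategy_shrink[OF finX cX finH codeg _ p _ _ _ res _ k])
        show "\<epsilon> * real n * real n \<le> real (card (arith_progs_in q ?X))"
          using False by (simp add: power2_eq_square)
      qed (use assms(1-3) in \<open>auto simp: \<I>_def arith_progs_in_def\<close>)
      then show ?thesis
      proof (rule strategy_weaken)
        fix A' B'
        assume *: "real (card (?X - container \<I> A' B')) \<ge> \<delta> * real n" "A \<subseteq> A'" "B \<subseteq> B'"
        then have "container \<I> A' B' \<subseteq> ?X" by (intro container_antimono)
        then have "card ?X = card (?X - container \<I> A' B') + card (container \<I> A' B')"
          using finX by (metis card_Diff_subset card_mono finite_subset le_add_diff_inverse2)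
        with * AB False have "?small (Suc j) A' B'" by (simp add: algebra_simps)
        then show "?few A' B' \<or> ?small (Suc j) A' B'" ..
      qed
    qed
  qed
  then show ?case by (simp only: mult_Suc add.commute)
qed

section \<open>Choice of the parameters and conclusion\<close>

theorem theorem2p7:
  fixes q :: nat and \<epsilon> :: real
  assumes "q \<ge> 3" and "\<epsilon> > 0"
  shows "\<exists>D :: real. \<forall>n :: nat. n \<ge> 1 \<longrightarrow>
    (\<exists>(\<G> :: nat set set) (f :: nat set \<Rightarrow> nat set).
       \<G> \<subseteq> Pow {1..n} \<and> f \<in> Pow {1..n} \<rightarrow> \<G> \<and>
       (\<forall>G \<in> \<G>. real (card (arith_progs_in q G)) < \<epsilon> * real n ^ 2) \<and>
       (\<forall>I. I \<subseteq> {1..n} \<and> arith_progs_in q I = {} \<longrightarrow>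
          (\<exists>S. S \<subseteq> I \<and>
               real (card S) \<le> D * real n powr ((real q - 2) / (real q - 1)) \<and>
               I \<subseteq> f S)))"
proof -
  define \<delta> where "\<delta> = shrinkage (q - 1) \<epsilon> (real (q * q))"
  have \<delta>: "\<delta> > 0" unfolding \<delta>_def using assms by (intro shrinkage_pos) auto
  \<comment> \<open>After \<open>J\<close> passes the size bound would be negative, so only the
    alternative with few progressions remains.\<close>
  define J where "J = Suc (nat \<lceil>1 / \<delta>\<rceil>)"
  have "1 / \<delta> < real J" unfolding J_def by linarith
  then have J: "1 < real J * \<delta>" using \<delta> by (simp add: field_simps)
  show ?thesis
  \<comment> \<open>There are \<open>J\<close> passes of \<open>q - 1\<close> rounds with
    \<open>k\<close> positive answers each; the factor 2 pays for rounding \<open>k\<close>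
    up.\<close>
  proof (intro exI[of _ "2 * real J * (real q - 1)"] allI impI)
    fix n :: nat assume n: "n \<ge> 1"
    define p where "p = real n powr (- 1 / (real q - 1))"
    define k where "k = nat \<lceil>p * real n\<rceil>"
    define \<I> where "\<I> = {I. I \<subseteq> {1..n} \<and> arith_progs_in q I = {}}"
    let ?few = "\<lambda>G. G \<subseteq> {1..n} \<and> real (card (arith_progs_in q G)) < \<epsilon> * real n ^ 2"
    have p: "0 < p" "p \<le> 1"
      using n assms powr_mono[of "- 1 / (real q - 1)" 0 "real n"] by (auto simp: p_def)
    have "p ^ (q - 1) = real n powr (- 1)"
      unfolding p_def using n assms
      by (simp add: powr_realpow[symmetric] powr_powr of_nat_diff)
    then have pq: "p ^ (q - 1) * real n = 1" using n by (simp add: powr_minus)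
    have "(real q - 2) / (real q - 1) = - 1 / (real q - 1) + 1"
      using assms by (simp add: field_simps)
    then have pn: "real n powr ((real q - 2) / (real q - 1)) = p * real n"
      unfolding p_def using n by (simp only: powr_add) simp
    \<comment> \<open>This makes rounding \<open>p * real n\<close> up cost at most a factor
      2.\<close>
    have "1 \<le> p * real n"
      unfolding pn[symmetric] using n assms by (intro ge_one_powr_ge_zero) auto
    then have k: "p * real n \<le> real k" "real k \<le> 2 * (p * real n)"
      unfolding k_def by linarith+
    have "strategy (\<lambda>A B. real (card (arith_progs_in q (container \<I> A B))) < \<epsilon> * real n ^ 2 \<or>
        real (card (container \<I> A B)) \<le> real n - real J * \<delta> * real n) {} {} (J * ((q - 1) * k))"
      unfolding \<I>_def \<delta>_def by (rule strategy_arith_progs[OF assms n p _ k(1)]) (simp only: pq order_refl)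
    then have "strategy (\<lambda>A B. ?few (container \<I> A B)) {} {} (J * ((q - 1) * k))"
    proof (rule strategy_weaken)
      fix A B
      assume *: "real (card (arith_progs_in q (container \<I> A B))) < \<epsilon> * real n ^ 2 \<or>
        real (card (container \<I> A B)) \<le> real n - real J * \<delta> * real n"
      have "1 * real n < real J * \<delta> * real n" using J n by (intro mult_strict_right_mono) auto
      with * have "real (card (arith_progs_in q (container \<I> A B))) < \<epsilon> * real n ^ 2" by linarith
      then show "?few (container \<I> A B)" unfolding container_def \<I>_def by auto
    qed
    from strategy_imp_containers[OF this] obtain f where f: "\<forall>S. ?few (f S)"
      and cover: "\<forall>I\<in>\<I>. finite I \<longrightarrow> {} \<subseteq> I \<longrightarrow> I \<inter> {} = {} \<longrightarrow>
        (\<exists>S. {} \<subseteq> S \<and> S \<subseteq> I \<and> card (S - {}) \<le> J * ((q - 1) * k) \<and> I \<subseteq> f S)"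
      by - (elim exE conjE, rule that)
    show "\<exists>\<G> f. \<G> \<subseteq> Pow {1..n} \<and> f \<in> Pow {1..n} \<rightarrow> \<G> \<and>
       (\<forall>G \<in> \<G>. real (card (arith_progs_in q G)) < \<epsilon> * real n ^ 2) \<and>
       (\<forall>I. I \<subseteq> {1..n} \<and> arith_progs_in q I = {} \<longrightarrow>
          (\<exists>S. S \<subseteq> I \<and>
               real (card S) \<le> 2 * real J * (real q - 1) * real n powr ((real q - 2) / (real q - 1)) \<and>
               I \<subseteq> f S))"
    \<comment> \<open>All sets with few progressions may serve as \<open>\<G>\<close>, since every
      value of \<open>f\<close> is such a set.\<close>
    proof (intro exI[of _ "Collect ?few"] exI[of _ f] conjI allI impI)
      fix I assume "I \<subseteq> {1..n} \<and> arith_progs_in q I = {}"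
      then have "I \<in> \<I>" "finite I" unfolding \<I>_def by (auto intro: finite_subset)
      with cover obtain S where S: "S \<subseteq> I" "card S \<le> J * ((q - 1) * k)" "I \<subseteq> f S"
        by fastforce
      have "real (card S) \<le> real J * (real (q - 1) * real k)"
        using S(2) by (metis of_nat_le_iff of_nat_mult)
      also have "\<dots> \<le> real J * (real (q - 1) * (2 * (p * real n)))"
        using k(2) by (intro mult_left_mono) auto
      also have "\<dots> = 2 * real J * (real q - 1) * real n powr ((real q - 2) / (real q - 1))"
        unfolding pn using assms by (simp add: of_nat_diff)
      finally show "\<exists>S. S \<subseteq> I \<and>
          real (card S) \<le> 2 * real J * (real q - 1) * real n powr ((real q - 2) / (real q - 1)) \<and>
          I \<subseteq> f S"
        using S by blast
    qed (use f in auto)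
  qed
qed

end
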